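(* Let $q=r(e^{\mathbf{i}\alpha}+e^{\mathbf{i}\beta}\mathbf{j})\in\mathbb{H}_s$ with $r>0$, $\alpha,\beta\in[0,2\pi)$, and let $n\ge 2$ be an integer. Then the equation $w^n=q$ has solution in the following cases: (1) $w=\sqrt[n]{\frac{r}{(2\cos\alpha)^{n-1}}}\,(e^{\mathbf{i}\alpha}+e^{\mathbf{i}\beta}\mathbf{j})$ if $\cos\alpha>0$, or if $\cos\alpha<0$ and $n$ is odd; (2) $w=\sqrt[n]{\frac{r}{(2\cos\alpha)^{n-1}}}\,(-e^{\mathbf{i}\alpha}-e^{\mathbf{i}\beta}\mathbf{j})$ if $\cos\alpha>0$ and $n$ is even.
   Context: $\mathbb{H}_s=\{q_0+q_1\mathbf{i}+q_2\mathbf{j}+q_3\mathbf{k}: q_i\in\mathbb{R}\}$ is the real associative algebra of split quaternions with basis $1,\mathbf{i},\mathbf{j},\mathbf{k}$ and $\mathbf{i}^2=-1$, $\mathbf{j}^2=\mathbf{k}^2=1$, $\mathbf{i}\mathbf{j}=\mathbf{k}=-\mathbf{j}\mathbf{i}$, $\mathbf{j}\mathbf{k}=-\mathbf{i}=-\mathbf{k}\mathbf{j}$, $\mathbf{k}\mathbf{i}=\mathbf{j}=-\mathbf{i}\mathbf{k}$. The subalgebra $\mathbb{R}+\mathbb{R}\mathbf{i}$ is identified with $\mathbb{C}$, and $e^{\mathbf{i}\theta}=\cos\theta+\mathbf{i}\sin\theta$. $\sqrt[n]{t}$ denotes the positive real $n$-th root of a real number $t>0$. *)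

theory Defs
  imports Complex_Main
begin

datatype split_quat = SQuat (sq_re: real) (sq_im1: real) (sq_im2: real) (sq_im3: real)

lemma split_quat_eq_iff:
  "p = q \<longleftrightarrow> sq_re p = sq_re q \<and> sq_im1 p = sq_im1 q \<and> sq_im2 p = sq_im2 q \<and> sq_im3 p = sq_im3 q"
  by (cases p; cases q) simp

instantiation split_quat :: real_algebra_1
begin

definition zero_split_quat :: split_quat
  where "0 = SQuat 0 0 0 0"

definition one_split_quat :: split_quat
  where "1 = SQuat 1 0 0 0"

definition plus_split_quat :: "split_quat \<Rightarrow> split_quat \<Rightarrow> split_quat"
  where "p + q = SQuat (sq_re p + sq_re q) (sq_im1 p + sq_im1 q) (sq_im2 p + sq_im2 q) (sq_im3 p + sq_im3 q)"

definition uminus_split_quat :: "split_quat \<Rightarrow> split_quat"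
  where "- p = SQuat (- sq_re p) (- sq_im1 p) (- sq_im2 p) (- sq_im3 p)"

definition minus_split_quat :: "split_quat \<Rightarrow> split_quat \<Rightarrow> split_quat"
  where "p - q = SQuat (sq_re p - sq_re q) (sq_im1 p - sq_im1 q) (sq_im2 p - sq_im2 q) (sq_im3 p - sq_im3 q)"

definition scaleR_split_quat :: "real \<Rightarrow> split_quat \<Rightarrow> split_quat"
  where "scaleR c p = SQuat (c * sq_re p) (c * sq_im1 p) (c * sq_im2 p) (c * sq_im3 p)"

(* The bilinear extension of the multiplication table of the basis 1, i, j, k;
   the table itself is recovered in the lemma sq_mult_table below. *)
definition times_split_quat :: "split_quat \<Rightarrow> split_quat \<Rightarrow> split_quat"
  where "p * q = SQuat
    (sq_re p * sq_re q - sq_im1 p * sq_im1 q + sq_im2 p * sq_im2 q + sq_im3 p * sq_im3 q)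
    (sq_re p * sq_im1 q + sq_im1 p * sq_re q - sq_im2 p * sq_im3 q + sq_im3 p * sq_im2 q)
    (sq_re p * sq_im2 q - sq_im1 p * sq_im3 q + sq_im2 p * sq_re q + sq_im3 p * sq_im1 q)
    (sq_re p * sq_im3 q + sq_im1 p * sq_im2 q - sq_im2 p * sq_im1 q + sq_im3 p * sq_re q)"

instance
  by standard
    (simp_all add: zero_split_quat_def one_split_quat_def plus_split_quat_def
      uminus_split_quat_def minus_split_quat_def scaleR_split_quat_def times_split_quat_def
      split_quat_eq_iff algebra_simps)

end

definition sq_i :: split_quat where "sq_i = SQuat 0 1 0 0"
definition sq_j :: split_quat where "sq_j = SQuat 0 0 1 0"
definition sq_k :: split_quat where "sq_k = SQuat 0 0 0 1"

lemma sq_mult_table: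
  "sq_i * sq_i = - 1" "sq_j * sq_j = 1" "sq_k * sq_k = 1"
  "sq_i * sq_j = sq_k" "sq_j * sq_i = - sq_k"
  "sq_j * sq_k = - sq_i" "sq_k * sq_j = sq_i"
  "sq_k * sq_i = sq_j" "sq_i * sq_k = - sq_j"
  by (simp_all add: sq_i_def sq_j_def sq_k_def times_split_quat_def one_split_quat_def
      uminus_split_quat_def)

lemma SQuat_basis:
  "SQuat a b c d = of_real a + b *\<^sub>R sq_i + c *\<^sub>R sq_j + d *\<^sub>R sq_k"
  by (simp add: of_real_def sq_i_def sq_j_def sq_k_def one_split_quat_def plus_split_quat_def
      scaleR_split_quat_def)

(* The identification of the complex numbers with the subalgebra spanned by 1 and i. *)
definition sq_of_complex :: "complex \<Rightarrow> split_quat"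
  where "sq_of_complex z = of_real (Re z) + Im z *\<^sub>R sq_i"

lemma sq_of_complex_hom:
  "sq_of_complex (of_real x) = of_real x" "sq_of_complex \<i> = sq_i"
  "sq_of_complex (z + z') = sq_of_complex z + sq_of_complex z'"
  "sq_of_complex (z * z') = sq_of_complex z * sq_of_complex z'"
  by (simp_all add: sq_of_complex_def of_real_def sq_i_def one_split_quat_def
      plus_split_quat_def scaleR_split_quat_def times_split_quat_def algebra_simps)

definition sq_cis :: "real \<Rightarrow> split_quat"
  where "sq_cis \<theta> = sq_of_complex (cis \<theta>)"

end

theory Submission imports Defs begin

text \<open>
  Put \<open>u = e\<^sup>i\<^sup>\<alpha> + e\<^sup>i\<^sup>\<beta> j\<close>, so that \<open>q = r u\<close>. The norm form
  \<open>N(a + b i + c j + d k) = a\<^sup>2 + b\<^sup>2 - c\<^sup>2 - d\<^sup>2\<close> is multiplicative and vanishes on \<open>u\<close>, hence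
  every solution \<open>w\<close> of \<open>w\<^sup>n = q\<close> has \<open>N(w) = 0\<close>. Every split quaternion satisfies
  \<open>w\<^sup>2 - 2 Re(w) w + N(w) = 0\<close>, so a null \<open>w\<close> has powers that are real multiples of \<open>w\<close> itself:
  \<open>w\<^sup>n = (2 Re w)\<^sup>n\<^sup>-\<^sup>1 w\<close> (lemma \<open>null_power\<close>). As \<open>q\<close> is nonzero, the solution \<open>w\<close> must be a real
  multiple \<open>s u\<close>, and since \<open>Re u = cos \<alpha>\<close>, the equation becomes the real equation
  \<open>s\<^sup>n (2 cos \<alpha>)\<^sup>n\<^sup>-\<^sup>1 = r\<close> (lemma \<open>power_eq_null_iff\<close>).

  It remains to count the real solutions \<open>s\<close>, with \<open>r > 0\<close>. There is none if \<open>cos \<alpha> = 0\<close>. For odd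
  \<open>n\<close> the factor \<open>(2 cos \<alpha>)\<^sup>n\<^sup>-\<^sup>1\<close> is positive and \<open>s\<close> is the \<open>n\<close>-th root of the quotient. For even \<open>n\<close>
  that factor has the sign of \<open>cos \<alpha>\<close>, while \<open>s\<^sup>n\<close> is nonnegative; so \<open>cos \<alpha>\<close> must be positive, and then
  both signs of the root are possible.
\<close>

definition sq_norm_form :: "split_quat \<Rightarrow> real"
  where "sq_norm_form p = (sq_re p)\<^sup>2 + (sq_im1 p)\<^sup>2 - (sq_im2 p)\<^sup>2 - (sq_im3 p)\<^sup>2"

lemma sq_norm_form_mult: "sq_norm_form (p * p') = sq_norm_form p * sq_norm_form p'"
  by (simp add: sq_norm_form_def times_split_quat_def power2_eq_square algebra_simps)

lemma sq_norm_form_power: "sq_norm_form (p ^ n) = sq_norm_form p ^ n"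
proof (induction n)
  case 0
  show ?case by (simp add: sq_norm_form_def one_split_quat_def)
next
  case (Suc n)
  then show ?case by (simp add: sq_norm_form_mult)
qed

lemma sq_norm_form_scaleR: "sq_norm_form (s *\<^sub>R p) = s\<^sup>2 * sq_norm_form p"
  by (simp add: sq_norm_form_def scaleR_split_quat_def power_mult_distrib algebra_simps)

lemma power_scaleR_algebra:
  fixes p :: "'a::real_algebra_1"
  shows "(s *\<^sub>R p) ^ n = s ^ n *\<^sub>R p ^ n"
  by (induction n) (simp_all add: mult.commute)

text \<open>The Cayley--Hamilton relation of the algebra of split quaternions, which is isomorphic to the
  algebra of real \<open>2 \<times> 2\<close> matrices with trace \<open>2 Re\<close> and determinant \<open>N\<close>.\<close>

lemma sq_quadratic_relation:
  "p * p = (2 * sq_re p) *\<^sub>R p - of_real (sq_norm_form p)"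
  by (simp add: sq_norm_form_def times_split_quat_def scaleR_split_quat_def minus_split_quat_def
      of_real_def one_split_quat_def power2_eq_square)

text \<open>By the quadratic relation, multiplying a power of a null element by that element only
  contributes the real factor \<open>2 Re p\<close>.\<close>

lemma null_power:
  assumes "sq_norm_form p = 0"
  shows "p ^ Suc m = (2 * sq_re p) ^ m *\<^sub>R p"
proof (induction m)
  case 0
  show ?case by simp
next
  case (Suc m)
  have "p ^ Suc (Suc m) = p * p ^ Suc m" by (rule power_Suc)
  also have "\<dots> = (2 * sq_re p) ^ m *\<^sub>R (p * p)" by (simp only: Suc mult_scaleR_right)
  also have "\<dots> = (2 * sq_re p) ^ Suc m *\<^sub>R p"
    using assms by (simp add: sq_quadratic_relation mult.commute)
  finally show ?case .
qed

text \<open>Roots of a nonzero null element \<open>r u\<close> lie on the real line through \<open>u\<close>, because a root is null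
  and is therefore proportional to its own power. This reduces the search for roots to one real
  unknown.\<close>

lemma power_eq_null_iff:
  fixes w u :: split_quat and r :: real
  assumes u: "sq_norm_form u = 0" "u \<noteq> 0" and r: "r \<noteq> 0"
  shows "w ^ Suc m = r *\<^sub>R u \<longleftrightarrow> (\<exists>s. w = s *\<^sub>R u \<and> s ^ Suc m * (2 * sq_re u) ^ m = r)"
proof -
  have line: "(s *\<^sub>R u) ^ Suc m = (s ^ Suc m * (2 * sq_re u) ^ m) *\<^sub>R u" for s
    unfolding power_scaleR_algebra null_power[OF u(1)] scaleR_scaleR by (rule refl)
  have "\<exists>s. w = s *\<^sub>R u" if eq: "w ^ Suc m = r *\<^sub>R u"
  proof -
    have "sq_norm_form w ^ Suc m = 0"
      using u(1) by (simp only: sq_norm_form_power[symmetric] eq sq_norm_form_scaleR mult_zero_right)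
    then have "sq_norm_form w = 0" by (rule power_eq_0_iff[THEN iffD1, THEN conjunct1])
    then have wu: "(2 * sq_re w) ^ m *\<^sub>R w = r *\<^sub>R u" using eq by (simp only: null_power)
    define t where "t = (2 * sq_re w) ^ m"
    have "t \<noteq> 0" using wu u(2) r unfolding t_def[symmetric] by auto
    then have "w = (r / t) *\<^sub>R u"
      using arg_cong[OF wu[folded t_def], of "scaleR (inverse t)"]
      by (simp add: divide_inverse mult.commute)
    then show ?thesis ..
  qed
  moreover have "(s *\<^sub>R u) ^ Suc m = r *\<^sub>R u \<longleftrightarrow> s ^ Suc m * (2 * sq_re u) ^ m = r" for s
    using u(2) by (simp only: line scaleR_cancel_right) simp
  ultimately show ?thesis by metis
qed

lemma real_power_eq_iff_root:
  fixes s x :: real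
  assumes "n > 0"
  shows "s ^ n = x \<longleftrightarrow> (if odd n then s = root n x else x \<ge> 0 \<and> (s = root n x \<or> s = - root n x))"
proof (cases "odd n")
  case True
  then show ?thesis using assms by (auto simp: odd_real_root_pow odd_real_root_power_cancel)
next
  case False
  then have ev: "even n" by simp
  have "\<bar>s\<bar> = root n (s ^ n)"
    using real_root_power_cancel[OF assms, of "\<bar>s\<bar>"] ev by (simp add: power_even_abs)
  then show ?thesis
    using assms ev by (auto simp: real_root_pow_pos2 zero_le_even_power)
qed

text \<open>No \<open>s\<close> works for \<open>c = 0\<close>, so let \<open>c\<close> be nonzero. For even \<open>m\<close> the factor \<open>c\<^sup>m\<close> is positive, and the exponent \<open>m + 1\<close> is odd,
  so one root exists. For odd \<open>m\<close> the power \<open>s\<^sup>m\<^sup>+\<^sup>1\<close> is nonnegative and \<open>c\<^sup>m\<close> has the sign of \<open>c\<close>, which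
  excludes negative \<open>c\<close>.\<close>

lemma real_scale_equation_iff:
  fixes s c r :: real
  assumes r: "r > 0" and m: "m > 0"
  shows "s ^ Suc m * c ^ m = r \<longleftrightarrow>
    ((c > 0 \<or> (c < 0 \<and> odd (Suc m))) \<and> s = root (Suc m) (r / c ^ m))
    \<or> ((c > 0 \<and> even (Suc m)) \<and> s = - root (Suc m) (r / c ^ m))"
proof (cases "c = 0")
  case True
  then show ?thesis using r m by (simp add: zero_power)
next
  case False
  then have cm: "c ^ m \<noteq> 0" by simp
  have div: "s ^ Suc m * c ^ m = r \<longleftrightarrow> s ^ Suc m = r / c ^ m"
    using cm by (simp add: eq_divide_eq)
  show ?thesis
  proof (cases "even m")
    case True
    then show ?thesis
      unfolding div real_power_eq_iff_root[OF zero_less_Suc] using False by auto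
  next
    case odd: False
    have "r / c ^ m \<ge> 0 \<longleftrightarrow> c > 0"
      using r cm odd False by (auto simp: zero_le_divide_iff zero_le_power_eq)
    then show ?thesis
      unfolding div real_power_eq_iff_root[OF zero_less_Suc] using odd by auto
  qed
qed

lemma sq_cis_null_element:
  "sq_cis \<alpha> + sq_cis \<beta> * sq_j = SQuat (cos \<alpha>) (sin \<alpha>) (cos \<beta>) (sin \<beta>)"
  by (simp add: sq_cis_def sq_of_complex_def of_real_def sq_i_def sq_j_def one_split_quat_def
      plus_split_quat_def scaleR_split_quat_def times_split_quat_def)

theorem theorem2p1:
  fixes r \<alpha> \<beta> :: real and n :: nat and q :: split_quat
  assumes "r > 0"
    and "\<alpha> \<in> {0..<2 * pi}"
    and "\<beta> \<in> {0..<2 * pi}"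
    and "n \<ge> 2"
    and "q = r *\<^sub>R (sq_cis \<alpha> + sq_cis \<beta> * sq_j)"
  shows "\<forall>w :: split_quat. w ^ n = q \<longleftrightarrow>
      ((cos \<alpha> > 0 \<or> (cos \<alpha> < 0 \<and> odd n)) \<and>
        w = root n (r / (2 * cos \<alpha>) ^ (n - 1)) *\<^sub>R (sq_cis \<alpha> + sq_cis \<beta> * sq_j))
    \<or> ((cos \<alpha> > 0 \<and> even n) \<and>
        w = root n (r / (2 * cos \<alpha>) ^ (n - 1)) *\<^sub>R (- sq_cis \<alpha> - sq_cis \<beta> * sq_j))"
proof
  fix w :: split_quat
  define u where "u = sq_cis \<alpha> + sq_cis \<beta> * sq_j"
  have re: "sq_re u = cos \<alpha>" by (simp add: u_def sq_cis_null_element)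
  have null: "sq_norm_form u = 0"
    by (simp add: u_def sq_cis_null_element sq_norm_form_def diff_diff_eq)
  have "u \<noteq> 0"
    \<comment> \<open>The complex part of \<open>u\<close> lies on the unit circle.\<close>
    using sin_zero_abs_cos_one[of \<alpha>] by (auto simp: u_def sq_cis_null_element zero_split_quat_def)
  obtain m where n: "n = Suc m" and m: "m > 0" using assms(4) by (cases n) auto
  have neg: "root n x *\<^sub>R (- sq_cis \<alpha> - sq_cis \<beta> * sq_j) = (- root n x) *\<^sub>R u" for x
    by (simp add: u_def algebra_simps)
  have sgn: "0 < 2 * cos \<alpha> \<longleftrightarrow> 0 < cos \<alpha>" "2 * cos \<alpha> < 0 \<longleftrightarrow> cos \<alpha> < 0"
    by auto
  have "w ^ n = q \<longleftrightarrow> (\<exists>s. w = s *\<^sub>R u \<and> s ^ Suc m * (2 * cos \<alpha>) ^ m = r)"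
    using power_eq_null_iff[OF null \<open>u \<noteq> 0\<close>, of r w m] assms(1)
    unfolding n re assms(5) u_def[symmetric] by blast
  also have "\<dots> \<longleftrightarrow>
      ((cos \<alpha> > 0 \<or> (cos \<alpha> < 0 \<and> odd n)) \<and> w = root n (r / (2 * cos \<alpha>) ^ m) *\<^sub>R u)
    \<or> ((cos \<alpha> > 0 \<and> even n) \<and> w = (- root n (r / (2 * cos \<alpha>) ^ m)) *\<^sub>R u)"
    unfolding real_scale_equation_iff[OF assms(1) m] n sgn by blast
  finally show "w ^ n = q \<longleftrightarrow>
      ((cos \<alpha> > 0 \<or> (cos \<alpha> < 0 \<and> odd n)) \<and>
        w = root n (r / (2 * cos \<alpha>) ^ (n - 1)) *\<^sub>R (sq_cis \<alpha> + sq_cis \<beta> * sq_j))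
    \<or> ((cos \<alpha> > 0 \<and> even n) \<and>
        w = root n (r / (2 * cos \<alpha>) ^ (n - 1)) *\<^sub>R (- sq_cis \<alpha> - sq_cis \<beta> * sq_j))"
    unfolding neg by (simp add: n u_def)
qed

end
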